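(* Let $X$ be a finite $2$-homogeneous metric space with $n:=|X|\ge 1$ elements, where $n=2^m(2k+1)$ with integers $m,k\ge0$. Then $\delta(X)\le 2^m(k+1)$.
   Context: A metric space $X$ is $2$-homogeneous if every bijective isometry $f\colon A\to B$ between subspaces $A,B\subseteq X$ with $|A|\le 2$ extends to a bijective isometry $X\to X$. $\delta(X)$ denotes the number of distinct values $d(x,y)$, $x,y\in X$ (including the value $0$). *)

theory Defs
  imports "HOL-Analysis.Analysis"
begin

text \<open>
  Metric spaces are given by a carrier \<open>X\<close> and a distance \<open>d\<close> in the sense of the library locale
  \<^locale>\<open>Metric_space\<close>; subspaces of \<open>X\<close> are subsets of the carrier with the restricted distance.
  Maps are total functions on the ambient type, of which only the values on the domain matter.
\<close>

definition bij_isometry_on :: "('a \<Rightarrow> 'a \<Rightarrow> real) \<Rightarrow> ('a \<Rightarrow> 'a) \<Rightarrow> 'a set \<Rightarrow> 'a set \<Rightarrow> bool" where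
  "bij_isometry_on d f A B \<longleftrightarrow>
     bij_betw f A B \<and> (\<forall>x\<in>A. \<forall>y\<in>A. d (f x) (f y) = d x y)"

text \<open>
  The condition \<open>finite A\<close> is needed because \<^const>\<open>card\<close> is \<open>0\<close> on infinite sets.
\<close>

definition two_homogeneous :: "'a set \<Rightarrow> ('a \<Rightarrow> 'a \<Rightarrow> real) \<Rightarrow> bool" where
  "two_homogeneous X d \<longleftrightarrow>
     (\<forall>A B f. A \<subseteq> X \<and> B \<subseteq> X \<and> finite A \<and> card A \<le> 2 \<and> bij_isometry_on d f A B \<longrightarrow>
        (\<exists>g. bij_isometry_on d g X X \<and> (\<forall>x\<in>A. g x = f x)))"

text \<open>
  The diagonal pairs contribute the value \<open>0\<close>, which is counted. The number is meaningful only if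
  there are finitely many distances, in particular for finite \<open>X\<close>.
\<close>

definition num_distances :: "'a set \<Rightarrow> ('a \<Rightarrow> 'a \<Rightarrow> real) \<Rightarrow> nat" where
  "num_distances X d = card {d x y | x y. x \<in> X \<and> y \<in> X}"

end

theory Submission
  imports Defs "HOL-Algebra.Sylow" "HOL-Algebra.Multiplicative_Group"
begin

text \<open>
  Fix a point \<open>x0\<close>. Since the isometries act transitively on \<open>X\<close>, every distance is a value
  \<open>d x0 y\<close>, so the distances correspond to the spheres around \<open>x0\<close>, which partition \<open>X\<close>. A sphere
  that is not a single point uses up at least two points. Hence, if \<open>t\<close> spheres are single points,
  the number \<open>\<delta>\<close> of distances satisfies \<open>t + 2 (\<delta> - t) \<le> n\<close>, that is, \<open>2 \<delta> \<le> n + t\<close>, and it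
  suffices to show \<open>t \<le> 2 ^ m\<close>.

  If the sphere of radius \<open>r\<close> around \<open>x0\<close> is a single point, the same holds around every point.
  Sending each point to the unique point at distance \<open>r\<close> is then a permutation of \<open>X\<close> that commutes
  with all isometries, and \<open>r\<close> can be recovered from it. So \<open>t\<close> is at most the order of the
  centralizer \<open>T\<close> of the isometry group in the symmetric group of \<open>X\<close>.

  The order of \<open>T\<close> is at most \<open>2 ^ m\<close> for two reasons. Every \<open>f\<close> in \<open>T\<close> is an involution: some isometry
  \<open>g\<close> swaps \<open>x\<close> and \<open>f x\<close>, whence \<open>f (f x) = f (g x) = g (f x) = x\<close>; so the order of \<open>T\<close> is a
  power of two by Cauchy's theorem. And \<open>T\<close> acts semiregularly, because an \<open>f\<close> in \<open>T\<close> with one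
  fixed point fixes its whole orbit under the isometries, which is \<open>X\<close>; so the order of \<open>T\<close>
  divides \<open>n = 2 ^ m * (2 * k + 1)\<close>.
\<close>

section \<open>Finite groups of exponent two\<close>

text \<open>
  An odd prime factor of the order would give a subgroup of that prime order, hence an element
  of that order, but all elements have order at most two.
\<close>

lemma (in group) order_power_of_2_if_involutions:
  assumes fin: "finite (carrier G)"
    and inv: "\<And>x. x \<in> carrier G \<Longrightarrow> x \<otimes> x = \<one>"
  shows "\<exists>j. order G = 2 ^ j"
proof -
  have two: "p = 2" if p: "prime p" "p dvd order G" for p :: nat
  proof -
    obtain c where "order G = p ^ 1 * c" using p(2) by auto
    then obtain H where H: "subgroup H G" "card H = p ^ 1"
      using sylow_thm[OF p(1) is_group _ fin] by blast
    have "H \<noteq> {\<one>}" using H(2) p(1) by (auto simp: prime_nat_iff)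
    moreover have "\<one> \<in> H" using H(1) by (rule subgroup.one_closed)
    ultimately obtain x where x: "x \<in> H" "x \<noteq> \<one>" by blast
    have xc: "x \<in> carrier G" using x(1) H(1) subgroup.mem_carrier by metis
    have "x [^] p = \<one>"
      using subgroup_imp_group[OF H(1)] group.pow_order_eq_1[of "G\<lparr>carrier := H\<rparr>" x] x(1) H(2)
      by (simp add: order_def nat_pow_consistent[symmetric])
    hence "ord x dvd p" using xc by (simp add: pow_eq_id)
    moreover have "x [^] (2::nat) = \<one>" using inv[OF xc] xc by (simp add: numeral_2_eq_2)
    hence "ord x dvd 2" using xc by (simp add: pow_eq_id)
    moreover have "ord x \<noteq> 1" using x(2) xc ord_eq_1 by blast
    ultimately show "p = 2" using p(1) two_is_prime_nat by (metis prime_nat_iff)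
  qed
  have "order G \<noteq> 0" using fin by (simp add: order_gt_0_iff_finite)
  moreover have "\<not> (\<exists>p. prime p \<and> p dvd order G \<and> p \<noteq> 2)" using two by blast
  ultimately show ?thesis
    using Ex_other_prime_factor[of "order G" 2] two_is_prime_nat by auto
qed

section \<open>Isometries of two-homogeneous spaces\<close>

lemma two_homogeneous_extend_pair:
  assumes "Metric_space X d" "two_homogeneous X d"
    and X: "x \<in> X" "y \<in> X" "x' \<in> X" "y' \<in> X" and eq: "d x y = d x' y'"
  obtains g where "bij_isometry_on d g X X" "g x = x'" "g y = y'"
proof -
  interpret Metric_space X d by fact
  let ?f = "\<lambda>z. if z = x then x' else y'"
  have xy: "x = y \<longleftrightarrow> x' = y'" using eq X zero by metis
  have "bij_isometry_on d ?f {x, y} {x', y'}"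
    using eq X xy commute unfolding bij_isometry_on_def bij_betw_def inj_on_def by auto
  moreover have "card {x, y} \<le> 2" by (simp add: card_insert_if)
  moreover have "{x, y} \<subseteq> X" "{x', y'} \<subseteq> X" "finite {x, y}" using X by auto
  ultimately obtain g where "bij_isometry_on d g X X" "\<forall>z\<in>{x, y}. g z = ?f z"
    using assms(2) unfolding two_homogeneous_def by blast
  thus ?thesis using that xy by auto
qed

lemma two_homogeneous_transitive:
  assumes "Metric_space X d" "two_homogeneous X d" "x \<in> X" "y \<in> X"
  obtains g where "bij_isometry_on d g X X" "g x = y"
proof (rule two_homogeneous_extend_pair[OF assms(1,2) assms(3,3) assms(4,4)])
  show "d x x = d y y" using assms by (simp add: Metric_space.mdist_zero)
qed (use that in blast)

section \<open>The centralizer of the isometry group\<close>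

text \<open>
  Isometries are arbitrary outside \<open>X\<close>, so commutation is required on \<open>X\<close> only; the elements of the
  centralizer are instead fixed to be the identity outside \<open>X\<close>, so that they are equal as functions
  when they agree on \<open>X\<close>.
\<close>

definition isometry_centralizer :: "'a set \<Rightarrow> ('a \<Rightarrow> 'a \<Rightarrow> real) \<Rightarrow> ('a \<Rightarrow> 'a) set" where
  "isometry_centralizer X d =
     {f. f permutes X \<and> (\<forall>g. bij_isometry_on d g X X \<longrightarrow> (\<forall>x\<in>X. f (g x) = g (f x)))}"

lemma isometry_centralizer_commute:
  "f \<in> isometry_centralizer X d \<Longrightarrow> bij_isometry_on d g X X \<Longrightarrow> x \<in> X \<Longrightarrow> f (g x) = g (f x)"
  by (auto simp: isometry_centralizer_def)

lemma isometry_centralizer_permutes: "f \<in> isometry_centralizer X d \<Longrightarrow> f permutes X"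
  by (auto simp: isometry_centralizer_def)

lemma isometry_centralizer_compose:
  assumes "f \<in> isometry_centralizer X d" "h \<in> isometry_centralizer X d"
  shows "f \<circ> h \<in> isometry_centralizer X d"
  using assms permutes_compose[of h X f]
  by (auto simp: isometry_centralizer_def permutes_in_image)

text \<open>The isometry that swaps \<open>x\<close> and \<open>f x\<close> commutes with \<open>f\<close>.\<close>

lemma isometry_centralizer_involution:
  assumes M: "Metric_space X d" and H: "two_homogeneous X d" and f: "f \<in> isometry_centralizer X d"
  shows "f \<circ> f = id"
proof
  fix x
  have p: "f permutes X" using f by (rule isometry_centralizer_permutes)
  show "(f \<circ> f) x = id x"
  proof (cases "x \<in> X")
    case True
    hence fx: "f x \<in> X" using p by (simp add: permutes_in_image)
    obtain g where g: "bij_isometry_on d g X X" "g x = f x" "g (f x) = x"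
      using two_homogeneous_extend_pair[OF M H True fx fx True] Metric_space.commute[OF M] by metis
    show ?thesis using isometry_centralizer_commute[OF f g(1) True] g by simp
  next
    case False
    thus ?thesis using p by (simp add: permutes_not_in)
  qed
qed

text \<open>Transitivity of the isometries transports the coincidence of \<open>f\<close> and \<open>h\<close> from one point to all.\<close>

lemma isometry_centralizer_semiregular:
  assumes M: "Metric_space X d" and H: "two_homogeneous X d"
    and f: "f \<in> isometry_centralizer X d" and h: "h \<in> isometry_centralizer X d"
    and x: "x \<in> X" "f x = h x"
  shows "f = h"
proof
  fix y
  show "f y = h y"
  proof (cases "y \<in> X")
    case True
    obtain g where g: "bij_isometry_on d g X X" "g x = y"
      using two_homogeneous_transitive[OF M H x(1) True] .
    show ?thesis using isometry_centralizer_commute[OF f g(1) x(1)]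
        isometry_centralizer_commute[OF h g(1) x(1)] g(2) x(2) by simp
  next
    case False
    thus ?thesis using f h by (metis isometry_centralizer_permutes permutes_not_in)
  qed
qed

lemma finite_isometry_centralizer: "finite X \<Longrightarrow> finite (isometry_centralizer X d)"
  by (rule finite_subset[OF _ finite_permutations[of X]]) (auto simp: isometry_centralizer_def)

lemma id_in_isometry_centralizer: "id \<in> isometry_centralizer X d"
  by (auto simp: isometry_centralizer_def permutes_id)

lemma card_isometry_centralizer_power_of_2:
  assumes M: "Metric_space X d" and H: "two_homogeneous X d" and fin: "finite X"
  shows "\<exists>j. card (isometry_centralizer X d) = 2 ^ j"
proof -
  let ?G = "\<lparr>carrier = isometry_centralizer X d, mult = (\<circ>), one = id\<rparr>"
  have "group ?G"
    using isometry_centralizer_involution[OF M H]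
    by (intro groupI)
      (auto simp: isometry_centralizer_compose id_in_isometry_centralizer comp_assoc)
  then interpret group ?G .
  show ?thesis
    using order_power_of_2_if_involutions isometry_centralizer_involution[OF M H]
      finite_isometry_centralizer[OF fin] by (simp add: order_def)
qed

text \<open>By semiregularity, every orbit of the centralizer on \<open>X\<close> is a copy of the centralizer.\<close>

lemma card_isometry_centralizer_dvd:
  assumes M: "Metric_space X d" and H: "two_homogeneous X d" and fin: "finite X"
  shows "card (isometry_centralizer X d) dvd card X"
proof -
  let ?T = "isometry_centralizer X d"
  let ?R = "{(x, y). x \<in> X \<and> (\<exists>f\<in>?T. y = f x)}"
  have R_X: "?R \<subseteq> X \<times> X"
    using isometry_centralizer_permutes by (force simp: permutes_in_image)
  have "refl_on X ?R"
    using id_in_isometry_centralizer[of X d] by (auto simp: refl_on_def intro!: bexI[of _ id])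
  moreover have "sym ?R"
  proof (rule symI)
    fix x y assume xy: "(x, y) \<in> ?R"
    then obtain f where f: "f \<in> ?T" "y = f x" by auto
    have "x = f y" using isometry_centralizer_involution[OF M H f(1)] f(2)
      by (metis comp_apply id_apply)
    thus "(y, x) \<in> ?R" using xy R_X f by auto
  qed
  moreover have "trans ?R"
  proof (rule transI)
    fix x y z assume "(x, y) \<in> ?R" "(y, z) \<in> ?R"
    then obtain f h where "x \<in> X" "f \<in> ?T" "h \<in> ?T" "z = (h \<circ> f) x" by auto
    thus "(x, z) \<in> ?R" using isometry_centralizer_compose[of h X d f] by blast
  qed
  ultimately have "equiv X ?R" using R_X by (simp add: equiv_def)
  moreover have "card ?T dvd card C" if C: "C \<in> X // ?R" for C
  proof -
    obtain x where x: "x \<in> X" "C = ?R `` {x}" using quotientE[OF C] by blast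
    hence "C = (\<lambda>f. f x) ` ?T" by auto
    moreover have "inj_on (\<lambda>f. f x) ?T"
      using isometry_centralizer_semiregular[OF M H] x(1) by (auto simp: inj_on_def)
    ultimately show ?thesis by (simp add: card_image)
  qed
  ultimately show ?thesis using equiv_imp_dvd_card[OF fin] by blast
qed

section \<open>Spheres consisting of a single point\<close>

definition singleton_radii :: "'a set \<Rightarrow> ('a \<Rightarrow> 'a \<Rightarrow> real) \<Rightarrow> 'a \<Rightarrow> real set" where
  "singleton_radii X d x = {r. \<exists>!y. y \<in> X \<and> d x y = r}"

text \<open>An isometry that moves \<open>x\<close> to \<open>z\<close> maps the spheres around \<open>x\<close> onto the spheres around \<open>z\<close>.\<close>

lemma singleton_radii_subset:
  assumes M: "Metric_space X d" and H: "two_homogeneous X d" and x: "x \<in> X" and z: "z \<in> X"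
  shows "singleton_radii X d x \<subseteq> singleton_radii X d z"
proof
  fix r assume "r \<in> singleton_radii X d x"
  then obtain y where y: "y \<in> X" "d x y = r" "\<And>y'. y' \<in> X \<Longrightarrow> d x y' = r \<Longrightarrow> y' = y"
    by (auto simp: singleton_radii_def)
  obtain g where g: "bij_isometry_on d g X X" "g x = z"
    using two_homogeneous_transitive[OF M H x z] .
  have d: "d z (g y') = d x y'" if "y' \<in> X" for y'
    using g x that by (auto simp: bij_isometry_on_def)
  have im: "g ` X = X" using g(1) by (auto simp: bij_isometry_on_def bij_betw_def)
  have "g y \<in> X \<and> d z (g y) = r" using d[OF y(1)] y(1,2) im by blast
  moreover have "w = g y" if "w \<in> X" "d z w = r" for w
  proof -
    obtain y' where "y' \<in> X" "w = g y'" using im \<open>w \<in> X\<close> by auto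
    thus ?thesis using d y(3) that(2) by auto
  qed
  ultimately show "r \<in> singleton_radii X d z" unfolding singleton_radii_def by blast
qed

text \<open>
  The map to the unique point at distance \<open>r\<close> is defined by the metric alone, so it commutes with
  isometries, and it is its own inverse because the metric is symmetric.
\<close>

lemma centralizer_element_of_singleton_radius:
  assumes M: "Metric_space X d" and H: "two_homogeneous X d" and x: "x \<in> X"
    and r: "r \<in> singleton_radii X d x"
  shows "\<exists>f\<in>isometry_centralizer X d. d x (f x) = r"
proof -
  define f where "f z = (if z \<in> X then THE y. y \<in> X \<and> d z y = r else z)" for z
  have ex1: "\<exists>!y. y \<in> X \<and> d z y = r" if "z \<in> X" for z
    using singleton_radii_subset[OF M H x that] r by (auto simp: singleton_radii_def)
  have f: "f z \<in> X \<and> d z (f z) = r" if "z \<in> X" for z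
    using theI'[OF ex1[OF that]] that by (simp add: f_def)
  have f_eq: "f z = y" if "z \<in> X" "y \<in> X" "d z y = r" for z y
    using ex1[OF that(1)] f[OF that(1)] that by blast
  have ff: "f (f z) = z" for z
  proof (cases "z \<in> X")
    case True
    thus ?thesis using f[OF True] f_eq Metric_space.commute[OF M] by metis
  qed (simp add: f_def)
  have "bij_betw f X X" by (rule bij_betwI[where g = f]) (use f ff in auto)
  hence "f permutes X" by (rule bij_imp_permutes) (simp add: f_def)
  moreover have "f (g z) = g (f z)" if "bij_isometry_on d g X X" "z \<in> X" for g z
  proof (rule f_eq)
    have "g ` X = X" using that by (auto simp: bij_isometry_on_def bij_betw_def)
    thus "g z \<in> X" "g (f z) \<in> X" using f that by auto
    show "d (g z) (g (f z)) = r" using f that by (auto simp: bij_isometry_on_def)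
  qed
  ultimately have "f \<in> isometry_centralizer X d" by (auto simp: isometry_centralizer_def)
  thus ?thesis using f x by blast
qed

lemma card_singleton_radii_le:
  assumes "Metric_space X d" "two_homogeneous X d" "finite X" "x \<in> X"
  shows "card (singleton_radii X d x) \<le> card (isometry_centralizer X d)"
proof -
  have "singleton_radii X d x \<subseteq> (\<lambda>f. d x (f x)) ` isometry_centralizer X d"
    using centralizer_element_of_singleton_radius[OF assms(1,2,4)] by blast
  thus ?thesis using finite_isometry_centralizer[OF assms(3)] by (meson surj_card_le)
qed

section \<open>Counting distances\<close>

text \<open>By transitivity, all distances are already realized from any given point.\<close>

lemma num_distances_eq:
  assumes M: "Metric_space X d" and H: "two_homogeneous X d" and x: "x \<in> X"
  shows "num_distances X d = card (d x ` X)"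
proof -
  have "d y z \<in> d x ` X" if yz: "y \<in> X" "z \<in> X" for y z
  proof -
    obtain g where g: "bij_isometry_on d g X X" "g y = x"
      using two_homogeneous_transitive[OF M H yz(1) x] .
    have "d y z = d x (g z)" "g z \<in> X"
      using g yz by (auto simp: bij_isometry_on_def bij_betw_def)
    thus ?thesis by blast
  qed
  hence "{d y z | y z. y \<in> X \<and> z \<in> X} = d x ` X" using x by auto
  thus ?thesis by (simp add: num_distances_def)
qed

text \<open>
  A value of \<open>h\<close> with a one-element fibre contributes \<open>1 + 1\<close> on the right, any other value at
  least \<open>2 + 0\<close>.
\<close>

lemma twice_card_image_le:
  assumes "finite A"
  shows "2 * card (h ` A) \<le> card A + card {r. \<exists>!y. y \<in> A \<and> h y = r}"
proof -
  let ?U = "{r. \<exists>!y. y \<in> A \<and> h y = r}"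
  let ?F = "\<lambda>r. {y \<in> A. h y = r}"
  have fin: "finite (h ` A)" using assms by simp
  have U: "?U \<subseteq> h ` A" by blast
  have "2 \<le> card (?F r) + (if r \<in> ?U then 1 else 0)" if "r \<in> h ` A" for r
  proof -
    have "finite (?F r)" using assms by simp
    moreover have "?F r \<noteq> {}" using that by auto
    ultimately have "card (?F r) \<noteq> 0" by simp
    moreover have "r \<in> ?U" if "card (?F r) = 1"
    proof -
      from that obtain y where "?F r = {y}" by (rule card_1_singletonE)
      hence "\<And>z. z \<in> A \<and> h z = r \<longleftrightarrow> z = y" by blast
      thus ?thesis by simp
    qed
    ultimately show ?thesis by force
  qed
  hence "(\<Sum>r\<in>h ` A. 2) \<le> (\<Sum>r\<in>h ` A. card (?F r) + (if r \<in> ?U then 1 else 0))"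
    by (rule sum_mono)
  also have "\<dots> = (\<Sum>r\<in>h ` A. card (?F r)) + card (h ` A \<inter> ?U)"
    using fin by (simp add: sum.distrib sum.If_cases)
  also have "(\<Sum>r\<in>h ` A. card (?F r)) = card A"
    using sum.image_gen[OF assms, of "\<lambda>_. 1::nat" h] by simp
  also have "h ` A \<inter> ?U = ?U" using U by blast
  finally show ?thesis by simp
qed

theorem theorem6p4:
  fixes X :: "'a set" and d :: "'a \<Rightarrow> 'a \<Rightarrow> real" and n m k :: nat
  assumes "Metric_space X d"
    and "finite X"
    and "two_homogeneous X d"
    and "n = card X"
    and "n \<ge> 1"
    and "n = 2 ^ m * (2 * k + 1)"
  shows "num_distances X d \<le> 2 ^ m * (k + 1)"
proof -
  obtain x where x: "x \<in> X" using assms(4,5) by fastforce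
  let ?t = "card (isometry_centralizer X d)"
  obtain j where j: "?t = 2 ^ j"
    using card_isometry_centralizer_power_of_2[OF assms(1,3,2)] by blast
  have "2 ^ j dvd 2 ^ m * (2 * k + 1)"
    using card_isometry_centralizer_dvd[OF assms(1,3,2)] j assms(4,6) by simp
  moreover have "coprime (2 ^ j) (2 * k + 1)" by simp
  ultimately have "2 ^ j dvd (2 ^ m :: nat)" by (simp only: coprime_dvd_mult_left_iff)
  hence t: "?t \<le> 2 ^ m" using j by (simp add: dvd_imp_le)
  have "2 * num_distances X d \<le> n + card (singleton_radii X d x)"
    using twice_card_image_le[OF assms(2), of "d x"]
    by (simp add: num_distances_eq[OF assms(1,3) x] singleton_radii_def assms(4))
  also have "\<dots> \<le> n + 2 ^ m"
    using card_singleton_radii_le[OF assms(1,3,2) x] t by simp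
  also have "\<dots> = 2 * (2 ^ m * (k + 1))" using assms(6) by (simp add: algebra_simps)
  finally show ?thesis by simp
qed

end
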